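(* Let $\mathcal{S}$ and $\mathcal{T}$ be finite semigroupoids. If $\varphi:\mathcal{S}\twoheadrightarrow\mathcal{T}$ is a surjective relational functor, then the pinhole cascade product $\mathcal{T}\wr_{\varphi}\mathcal{K}_\varphi$ emulates $\mathcal{S}$, i.e., $\mathcal{S}\hookrightarrow\mathcal{T}\wr_{\varphi}\mathcal{K}_\varphi$: there exists an injective relational functor from $\mathcal{S}$ to $\mathcal{T}\wr_{\varphi}\mathcal{K}_\varphi$.
   Context: All structures are finite. Composition is written left to right: for $f:X\to Y$ and $g:Y\to Z$ the composite is $fg:X\to Z$. **Semigroupoid.** A semigroupoid $\mathcal{S}$ consists of a set of objects $\mathrm{Ob}(\mathcal{S})$, a set of arrows $\mathcal{S}(X,Y)$ for each $X,Y\in\mathrm{Ob}(\mathcal{S})$, and composition functions $\mathcal{S}(X,Y)\times\mathcal{S}(Y,Z)\to\mathcal{S}(X,Z)$, $(f,g)\mapsto fg$, satisfying $f(gh)=(fg)h$ whenever $f\in\mathcal{S}(X,Y)$, $g\in\mathcal{S}(Y,Z)$, $h\in\mathcal{S}(Z,W)$ (a category without the requirement of identity arrows). The name $\mathcal{S}$ also denotes the total set of arrows. Arrows $f,g$ are composable (in this order) if $\mathrm{cod}(f)=\mathrm{dom}(g)$. For sets of arrows $A,B$, put $AB=\{ab\mid a\in A,\ b\in B,\ \mathrm{cod}(a)=\mathrm{dom}(b)\}$. **Relational functor.** A relational functor $\varphi:\mathcal{S}\to\mathcal{T}$ is a relation taking each arrow $f$ of $\mathcal{S}$ to a non-empty set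 $\varphi(f)$ of arrows of $\mathcal{T}$ (not necessarily all of the same type, i.e. domain-codomain pair), such that for all composable pairs $f:X\to Y$, $g:Y\to Z$ in $\mathcal{S}$: $\varphi(f)\varphi(g)\subseteq\varphi(fg)$ and $\varphi(f)\varphi(g)\neq\varnothing$. It is surjective (denoted $\twoheadrightarrow$) if $\bigcup_{f\in\mathcal{S}}\varphi(f)=\mathcal{T}$. It is injective (denoted $\hookrightarrow$; also called an emulation or covering) if $\varphi(f)\cap\varphi(g)\neq\varnothing$ implies $f=g$. For an arrow $t$ of $\mathcal{T}$, $\varphi^{-1}(t)=\{f\in\mathcal{S}\mid t\in\varphi(f)\}$. **Equivalent arrows.** Arrows $f:X\to Y$ and $g:Z\to U$ of $\mathcal{S}$ are equivalent (interchangeable) if there are arrows $m_{X\to Z}:X\to Z$, $m_{Z\to X}:Z\to X$, $m_{Y\to U}:Y\to U$, $m_{U\to Y}:U\to Y$ in $\mathcal{S}$ with $f=m_{X\to Z}\,g\,m_{U\to Y}$ and $g=m_{Z\to X}\,f\,m_{Y\to U}$, and moreover $m_{X\to Z}m_{Z\to X}f=f\,m_{Y\to U}m_{U\to Y}=f$ and similarly for $g$ (the pairs of maps are mutually inverse relative to $f$ and $g$). Any subsets of the four objects $X,Y,Z,U$ may coincide. **Equivalent sets of arrows.** For a set of arrows $P\subseteq\mathcal{S}$ let $\mathrm{Ob}|_P(\mathcal{S})$ be the set of objects occurring as a domain or codomain of an arrow in $P$. Sets of arrows $P,Q\subseteq\mathcal{S}$ are equivalent if their supporting sets of objects are isomorphic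 as sets in $\mathcal{S}$: there are families of arrows $m_{P\to Q}:\mathrm{Ob}|_P(\mathcal{S})\to\mathrm{Ob}|_Q(\mathcal{S})$ and $m_{Q\to P}:\mathrm{Ob}|_Q(\mathcal{S})\to\mathrm{Ob}|_P(\mathcal{S})$ of $\mathcal{S}$ inducing two bijections in opposite directions between $P$ and $Q$, and the arrows corresponding to pairs of objects are inverses of each other relative to the arrows of $P\cup Q$. For each equivalence class of preimages $\varphi^{-1}(f)$, $f\in\mathcal{T}$, a representative is chosen; $[\varphi^{-1}(f)]$ denotes the representative of the class of $\varphi^{-1}(f)$. The family of arrows from $\varphi^{-1}(f)$ to its representative is denoted $m_{f\to\ast}$, and the family from the representative to $\varphi^{-1}(f)$ is denoted $m_{\ast\to f}$. These maps may not exist for arrows with no other equivalent arrows. **Kernel.** The kernel $\mathcal{K}_\varphi$ of a relational functor $\varphi:\mathcal{S}\to\mathcal{T}$ is the semigroupoid $\mathcal{S}$ with equivalent preimages identified; formally $\mathcal{K}_\varphi=\bigcup_{f\in\mathcal{T}}[\varphi^{-1}(f)]$. **Encoding and decoding.** For an arrow $a\in\varphi^{-1}(f)$: if $a$ has at least one other equivalent arrow, then $\mathrm{enc}_f(a)=m_{\ast\to f}\,a\,m_{f\to\ast}$; otherwise $\mathrm{enc}_f(a)=a$. For an arrow $a'\in[\varphi^{-1}(f)]$: if $a'$ is interchangeable, then $\mathrm{dec}_f(a')=m_{f\to\ast}\,a'\,m_{\ast\to f}$; otherwise $\mathrm{dec}_f(a')=a'$. Here the members of the families $m_{f\to\ast}$,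 $m_{\ast\to f}$ are those at the relevant domain and codomain objects. Encoding followed by decoding, and vice versa, is the identity on the arrows in their scope. **Pinhole cascade product.** $\mathcal{T}\wr_{\varphi}\mathcal{K}_\varphi$ is the semigroupoid with arrows $\bigcup_{f\in\mathcal{T}}\{f\}\times[\varphi^{-1}(f)]$ and composition $$(f,a)(g,b)=\bigl(fg,\ \mathrm{enc}_{fg}(\mathrm{dec}_f(a)\,\mathrm{dec}_g(b))\bigr),$$ formed when $f,g$ are composable in $\mathcal{T}$ and $\mathrm{dec}_f(a),\mathrm{dec}_g(b)$ are composable in $\mathcal{S}$. *)

theory Defs
  imports Main
begin

section \<open>Semigroupoids\<close>

text \<open>Composition is written left to right: \<open>f \<cdot>\<^bsub>S\<^esub> g\<close> goes from the domain of \<open>f\<close> to the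
  codomain of \<open>g\<close>, and is meaningful only if \<open>Cod S f = Dom S g\<close>.\<close>

record ('o, 'a) sgpd =
  Ob :: "'o set"
  Arr :: "'a set"
  Dom :: "'a \<Rightarrow> 'o"
  Cod :: "'a \<Rightarrow> 'o"
  Comp :: "'a \<Rightarrow> 'a \<Rightarrow> 'a"  (infixl "\<cdot>\<index>" 70)

locale semigroupoid =
  fixes S :: "('o, 'a) sgpd" (structure)
  assumes Dom_in_Ob: "f \<in> Arr S \<Longrightarrow> Dom S f \<in> Ob S"
    and Cod_in_Ob: "f \<in> Arr S \<Longrightarrow> Cod S f \<in> Ob S"
    and Comp_in_Arr: "\<lbrakk>f \<in> Arr S; g \<in> Arr S; Cod S f = Dom S g\<rbrakk> \<Longrightarrow> f \<cdot> g \<in> Arr S"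
    and Dom_Comp: "\<lbrakk>f \<in> Arr S; g \<in> Arr S; Cod S f = Dom S g\<rbrakk> \<Longrightarrow> Dom S (f \<cdot> g) = Dom S f"
    and Cod_Comp: "\<lbrakk>f \<in> Arr S; g \<in> Arr S; Cod S f = Dom S g\<rbrakk> \<Longrightarrow> Cod S (f \<cdot> g) = Cod S g"
    and Comp_assoc: "\<lbrakk>f \<in> Arr S; g \<in> Arr S; h \<in> Arr S; Cod S f = Dom S g; Cod S g = Dom S h\<rbrakk>
      \<Longrightarrow> f \<cdot> (g \<cdot> h) = (f \<cdot> g) \<cdot> h"

locale finite_semigroupoid = semigroupoid +
  assumes finite_Ob: "finite (Ob S)"
    and finite_Arr: "finite (Arr S)"

definition hom :: "('o, 'a) sgpd \<Rightarrow> 'o \<Rightarrow> 'o \<Rightarrow> 'a set" where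
  "hom S X Y = {f \<in> Arr S. Dom S f = X \<and> Cod S f = Y}"

definition set_comp :: "('o, 'a) sgpd \<Rightarrow> 'a set \<Rightarrow> 'a set \<Rightarrow> 'a set" where
  "set_comp S A B = {Comp S a b | a b. a \<in> A \<and> b \<in> B \<and> Cod S a = Dom S b}"


section \<open>Relational functors\<close>

locale relational_functor = S: semigroupoid S + T: semigroupoid T
  for S :: "('o, 'a) sgpd" and T :: "('p, 'b) sgpd" +
  fixes \<phi> :: "'a \<Rightarrow> 'b set"
  assumes image_subset: "f \<in> Arr S \<Longrightarrow> \<phi> f \<subseteq> Arr T"
    and image_nonempty: "f \<in> Arr S \<Longrightarrow> \<phi> f \<noteq> {}"
    and comp_subset: "\<lbrakk>f \<in> Arr S; g \<in> Arr S; Cod S f = Dom S g\<rbrakk>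
      \<Longrightarrow> set_comp T (\<phi> f) (\<phi> g) \<subseteq> \<phi> (Comp S f g)"
    and comp_nonempty: "\<lbrakk>f \<in> Arr S; g \<in> Arr S; Cod S f = Dom S g\<rbrakk>
      \<Longrightarrow> set_comp T (\<phi> f) (\<phi> g) \<noteq> {}"

locale surjective_relational_functor = relational_functor +
  assumes surjective: "(\<Union>f\<in>Arr S. \<phi> f) = Arr T"

locale injective_relational_functor = relational_functor +
  assumes injective: "\<lbrakk>f \<in> Arr S; g \<in> Arr S; \<phi> f \<inter> \<phi> g \<noteq> {}\<rbrakk> \<Longrightarrow> f = g"

definition preim :: "('o, 'a) sgpd \<Rightarrow> ('a \<Rightarrow> 'b set) \<Rightarrow> 'b \<Rightarrow> 'a set" where
  "preim S \<phi> t = {f \<in> Arr S. t \<in> \<phi> f}"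


section \<open>Equivalence of arrows and of sets of arrows\<close>

definition equivalent_arrows :: "('o, 'a) sgpd \<Rightarrow> 'a \<Rightarrow> 'a \<Rightarrow> bool" where
  "equivalent_arrows S f g \<longleftrightarrow> f \<in> Arr S \<and> g \<in> Arr S \<and>
    (\<exists>m\<^sub>X\<^sub>Z \<in> hom S (Dom S f) (Dom S g). \<exists>m\<^sub>Z\<^sub>X \<in> hom S (Dom S g) (Dom S f).
     \<exists>m\<^sub>Y\<^sub>U \<in> hom S (Cod S f) (Cod S g). \<exists>m\<^sub>U\<^sub>Y \<in> hom S (Cod S g) (Cod S f).
       f = m\<^sub>X\<^sub>Z \<cdot>\<^bsub>S\<^esub> g \<cdot>\<^bsub>S\<^esub> m\<^sub>U\<^sub>Y \<and> g = m\<^sub>Z\<^sub>X \<cdot>\<^bsub>S\<^esub> f \<cdot>\<^bsub>S\<^esub> m\<^sub>Y\<^sub>U \<and>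
       m\<^sub>X\<^sub>Z \<cdot>\<^bsub>S\<^esub> m\<^sub>Z\<^sub>X \<cdot>\<^bsub>S\<^esub> f = f \<and> f \<cdot>\<^bsub>S\<^esub> m\<^sub>Y\<^sub>U \<cdot>\<^bsub>S\<^esub> m\<^sub>U\<^sub>Y = f \<and>
       m\<^sub>Z\<^sub>X \<cdot>\<^bsub>S\<^esub> m\<^sub>X\<^sub>Z \<cdot>\<^bsub>S\<^esub> g = g \<and> g \<cdot>\<^bsub>S\<^esub> m\<^sub>U\<^sub>Y \<cdot>\<^bsub>S\<^esub> m\<^sub>Y\<^sub>U = g)"

definition interchangeable :: "('o, 'a) sgpd \<Rightarrow> 'a \<Rightarrow> bool" where
  "interchangeable S a \<longleftrightarrow> (\<exists>b. b \<noteq> a \<and> equivalent_arrows S a b)"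

definition Ob_of :: "('o, 'a) sgpd \<Rightarrow> 'a set \<Rightarrow> 'o set" where
  "Ob_of S P = Dom S ` P \<union> Cod S ` P"

text \<open>A family from \<open>P\<close> to \<open>Q\<close> assigns to each supporting object \<open>X\<close> of \<open>P\<close> an arrow \<open>m X\<close>
  starting at \<open>X\<close> and ending at a supporting object of \<open>Q\<close>; the underlying map on objects is
  \<open>X \<mapsto> Cod S (m X)\<close>. Given families \<open>m\<close> from \<open>P\<close> to \<open>Q\<close> and \<open>n\<close> from \<open>Q\<close> to \<open>P\<close>, an arrow
  \<open>p : X \<rightarrow> Y\<close> of \<open>P\<close> is sent to \<open>n\<^bsub>X'\<^esub> p m\<^bsub>Y\<^esub>\<close>, where \<open>X'\<close> is the object of \<open>Q\<close> corresponding
  to \<open>X\<close>.\<close>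

definition conj_by :: "('o, 'a) sgpd \<Rightarrow> ('o \<Rightarrow> 'a) \<Rightarrow> ('o \<Rightarrow> 'a) \<Rightarrow> 'a \<Rightarrow> 'a" where
  "conj_by S m n p = n (Cod S (m (Dom S p))) \<cdot>\<^bsub>S\<^esub> p \<cdot>\<^bsub>S\<^esub> m (Cod S p)"

definition arrow_family :: "('o, 'a) sgpd \<Rightarrow> 'a set \<Rightarrow> 'a set \<Rightarrow> ('o \<Rightarrow> 'a) \<Rightarrow> bool" where
  "arrow_family S P Q m \<longleftrightarrow>
    (\<forall>X \<in> Ob_of S P. m X \<in> Arr S \<and> Dom S (m X) = X \<and> Cod S (m X) \<in> Ob_of S Q)"

text \<open>\<open>inverse_at S P m n\<close>: at every supporting object of \<open>P\<close>, going along \<open>m\<close> and back along \<open>n\<close>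
  returns to the same object and acts as an identity on the arrows of \<open>P\<close> there. Demanding this
  for \<open>P\<close> and, with the roles of \<open>m\<close> and \<open>n\<close> exchanged, for \<open>Q\<close> makes the two families inverse
  to each other relative to the arrows of \<open>P \<union> Q\<close>, exactly as for the equivalence of two single
  arrows; the maps on objects are then mutually inverse bijections.\<close>

definition inverse_at ::
    "('o, 'a) sgpd \<Rightarrow> 'a set \<Rightarrow> ('o \<Rightarrow> 'a) \<Rightarrow> ('o \<Rightarrow> 'a) \<Rightarrow> bool" where
  "inverse_at S P m n \<longleftrightarrow>
    (\<forall>X \<in> Ob_of S P. Cod S (n (Cod S (m X))) = X) \<and>
    (\<forall>p \<in> P. m (Dom S p) \<cdot>\<^bsub>S\<^esub> n (Cod S (m (Dom S p))) \<cdot>\<^bsub>S\<^esub> p = p \<and>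
             p \<cdot>\<^bsub>S\<^esub> m (Cod S p) \<cdot>\<^bsub>S\<^esub> n (Cod S (m (Cod S p))) = p)"

definition equivalence_families ::
    "('o, 'a) sgpd \<Rightarrow> 'a set \<Rightarrow> 'a set \<Rightarrow> ('o \<Rightarrow> 'a) \<Rightarrow> ('o \<Rightarrow> 'a) \<Rightarrow> bool" where
  "equivalence_families S P Q m n \<longleftrightarrow>
    arrow_family S P Q m \<and> arrow_family S Q P n \<and>
    bij_betw (conj_by S m n) P Q \<and> bij_betw (conj_by S n m) Q P \<and>
    inverse_at S P m n \<and> inverse_at S Q n m"

definition equivalent_sets :: "('o, 'a) sgpd \<Rightarrow> 'a set \<Rightarrow> 'a set \<Rightarrow> bool" where
  "equivalent_sets S P Q \<longleftrightarrow> (\<exists>m n. equivalence_families S P Q m n)"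


section \<open>Representatives of preimages and the kernel\<close>

definition preims :: "('o, 'a) sgpd \<Rightarrow> ('p, 'b) sgpd \<Rightarrow> ('a \<Rightarrow> 'b set) \<Rightarrow> 'a set set" where
  "preims S T \<phi> = preim S \<phi> ` Arr T"

text \<open>Since identity arrows need not exist, a set of arrows need not be equivalent to itself through
  families of arrows; equality is therefore added. This is an equivalence relation on the preimages,
  see \<open>equiv_preim_rel\<close> below.\<close>

definition preim_rel :: "('o, 'a) sgpd \<Rightarrow> ('p, 'b) sgpd \<Rightarrow> ('a \<Rightarrow> 'b set) \<Rightarrow> 'a set rel" where
  "preim_rel S T \<phi> =
    {(P, Q). P \<in> preims S T \<phi> \<and> Q \<in> preims S T \<phi> \<and> (P = Q \<or> equivalent_sets S P Q)}"

text \<open>The function \<open>rep\<close> chooses a member of each equivalence class of preimages.\<close>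

definition rep_preim ::
    "('o, 'a) sgpd \<Rightarrow> ('p, 'b) sgpd \<Rightarrow> ('a \<Rightarrow> 'b set) \<Rightarrow> ('a set set \<Rightarrow> 'a set) \<Rightarrow> 'b \<Rightarrow> 'a set" where
  "rep_preim S T \<phi> rep f = rep (preim_rel S T \<phi> `` {preim S \<phi> f})"

definition kernel ::
    "('o, 'a) sgpd \<Rightarrow> ('p, 'b) sgpd \<Rightarrow> ('a \<Rightarrow> 'b set) \<Rightarrow> ('a set set \<Rightarrow> 'a set) \<Rightarrow> 'a set" where
  "kernel S T \<phi> rep = (\<Union>f \<in> Arr T. rep_preim S T \<phi> rep f)"

definition has_families ::
    "('o, 'a) sgpd \<Rightarrow> ('p, 'b) sgpd \<Rightarrow> ('a \<Rightarrow> 'b set) \<Rightarrow> ('a set set \<Rightarrow> 'a set) \<Rightarrow> 'b \<Rightarrow> bool" where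
  "has_families S T \<phi> rep f \<longleftrightarrow> equivalent_sets S (preim S \<phi> f) (rep_preim S T \<phi> rep f)"

text \<open>The choices on which encoding and decoding depend: the representatives, and for each arrow \<open>f\<close>
  of \<open>T\<close> the families \<open>mto f\<close> (from the preimage of \<open>f\<close> to its representative) and \<open>mfrom f\<close>
  (back). Such families can fail to exist only if the preimage is its own representative; then \<open>mto f\<close>
  and \<open>mfrom f\<close> are unconstrained and play no role.\<close>

definition kernel_choice ::
    "('o, 'a) sgpd \<Rightarrow> ('p, 'b) sgpd \<Rightarrow> ('a \<Rightarrow> 'b set) \<Rightarrow>
     ('a set set \<Rightarrow> 'a set) \<Rightarrow> ('b \<Rightarrow> 'o \<Rightarrow> 'a) \<Rightarrow> ('b \<Rightarrow> 'o \<Rightarrow> 'a) \<Rightarrow> bool" where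
  "kernel_choice S T \<phi> rep mto mfrom \<longleftrightarrow>
    (\<forall>C \<in> preims S T \<phi> // preim_rel S T \<phi>. rep C \<in> C) \<and>
    (\<forall>f \<in> Arr T. has_families S T \<phi> rep f \<longrightarrow>
       equivalence_families S (preim S \<phi> f) (rep_preim S T \<phi> rep f) (mto f) (mfrom f))"


section \<open>Equivalence of preimages, and existence of the choices\<close>

context semigroupoid
begin

lemma assoc': "\<lbrakk>f \<in> Arr S; g \<in> Arr S; h \<in> Arr S; Cod S f = Dom S g; Cod S g = Dom S h\<rbrakk>
      \<Longrightarrow> (f \<cdot> g) \<cdot> h = f \<cdot> (g \<cdot> h)"
  by (simp add: Comp_assoc)

lemmas comp_simps = Comp_in_Arr Dom_Comp Cod_Comp assoc'

lemma inverse_at_trans: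
  assumes P: "P \<subseteq> Arr S" and Q: "Q \<subseteq> Arr S"
    and m: "arrow_family S P Q m" and n: "arrow_family S Q P n"
    and m': "arrow_family S Q R m'" and n': "arrow_family S R Q n'"
    and conj: "conj_by S m n ` P \<subseteq> Q"
    and inv: "inverse_at S P m n" and inv': "inverse_at S Q m' n'"
  defines "m'' \<equiv> (\<lambda>X. m X \<cdot> m' (Cod S (m X)))" and "n'' \<equiv> (\<lambda>Z. n' Z \<cdot> n (Cod S (n' Z)))"
  shows "inverse_at S P m'' n''" and "p \<in> P \<Longrightarrow> conj_by S m'' n'' p = conj_by S m' n' (conj_by S m n p)"
    and "arrow_family S P R m''"
proof -
  have fm: "m X \<in> Arr S" "Dom S (m X) = X" "Cod S (m X) \<in> Ob_of S Q" if "X \<in> Ob_of S P" for X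
    using m that by (auto simp: arrow_family_def)
  have fn: "n X \<in> Arr S" "Dom S (n X) = X" "Cod S (n X) \<in> Ob_of S P" if "X \<in> Ob_of S Q" for X
    using n that by (auto simp: arrow_family_def)
  have fm': "m' X \<in> Arr S" "Dom S (m' X) = X" "Cod S (m' X) \<in> Ob_of S R" if "X \<in> Ob_of S Q" for X
    using m' that by (auto simp: arrow_family_def)
  have fn': "n' X \<in> Arr S" "Dom S (n' X) = X" "Cod S (n' X) \<in> Ob_of S Q" if "X \<in> Ob_of S R" for X
    using n' that by (auto simp: arrow_family_def)
  have io: "Cod S (n (Cod S (m X))) = X" if "X \<in> Ob_of S P" for X
    using inv that by (auto simp: inverse_at_def)
  have io': "Cod S (n' (Cod S (m' X))) = X" if "X \<in> Ob_of S Q" for X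
    using inv' that by (auto simp: inverse_at_def)
  note ff = fm fn fm' fn' io io'
  have O: "Dom S p \<in> Ob_of S P" "Cod S p \<in> Ob_of S P" "p \<in> Arr S" if "p \<in> P" for p
    using that P by (auto simp: Ob_of_def)
  show fam: "arrow_family S P R m''"
    unfolding arrow_family_def m''_def by (simp add: ff comp_simps)
  have o2: "Cod S (n'' (Cod S (m'' X))) = X" if "X \<in> Ob_of S P" for X
    using that unfolding m''_def n''_def by (simp add: ff comp_simps)
  show "conj_by S m'' n'' p = conj_by S m' n' (conj_by S m n p)" if "p \<in> P" for p
    using that unfolding m''_def n''_def conj_by_def by (simp add: O ff comp_simps)
  show "inverse_at S P m'' n''"
    unfolding inverse_at_def
  proof (intro conjI ballI)
    fix X assume "X \<in> Ob_of S P" thus "Cod S (n'' (Cod S (m'' X))) = X" by (rule o2)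
  next
    fix p assume p: "p \<in> P"
    define X Y where "X = Dom S p" and "Y = Cod S p"
    define A B where "A = Cod S (m X)" and "B = Cod S (m Y)"
    define q where "q = conj_by S m n p"
    have q: "q \<in> Q" using conj p by (auto simp: q_def)
    have pX: "X \<in> Ob_of S P" "Y \<in> Ob_of S P" "p \<in> Arr S" using O[OF p] by (auto simp: X_def Y_def)
    have AB: "A \<in> Ob_of S Q" "B \<in> Ob_of S Q" using pX fm by (auto simp: A_def B_def)
    have t: "Dom S p = X" "Cod S p = Y" "Cod S (m X) = A" "Cod S (m Y) = B" 
        "Cod S (n A) = X" "Cod S (n B) = Y"
      using pX by (simp_all add: X_def Y_def A_def B_def io)
    have q': "q = n A \<cdot> (p \<cdot> m Y)"
      by (simp add: q_def conj_by_def t pX AB ff comp_simps)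
    have dq: "Dom S q = A" "Cod S q = B" "q \<in> Arr S"
      using pX AB by (simp_all add: q' ff comp_simps A_def B_def X_def[symmetric] Y_def[symmetric])
    note tt = t dq pX AB comp_simps ff
    have e1: "m X \<cdot> (n A \<cdot> p) = p" "p \<cdot> (m Y \<cdot> n B) = p"
      using inv p by (auto simp: inverse_at_def tt)
    have e2: "m' A \<cdot> (n' (Cod S (m' A)) \<cdot> q) = q" "q \<cdot> (m' B \<cdot> n' (Cod S (m' B))) = q"
      using inv' q by (auto simp: inverse_at_def tt)
    have pq: "p = m X \<cdot> (q \<cdot> n B)"
    proof -
      have "m X \<cdot> (q \<cdot> n B) = (m X \<cdot> (n A \<cdot> p)) \<cdot> (m Y \<cdot> n B)" 
        unfolding q' by (simp add: tt)
      thus ?thesis by (simp add: e1)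
    qed
    have nq: "n A \<cdot> p = q \<cdot> n B"
    proof -
      have "n A \<cdot> p = n A \<cdot> (p \<cdot> (m Y \<cdot> n B))" by (simp add: e1)
      also have "\<dots> = q \<cdot> n B" unfolding q' by (simp add: tt)
      finally show ?thesis .
    qed
    have mq: "p \<cdot> m Y = m X \<cdot> q"
    proof -
      have "p \<cdot> m Y = (m X \<cdot> (n A \<cdot> p)) \<cdot> m Y" by (simp add: e1)
      also have "\<dots> = m X \<cdot> q" unfolding q' by (simp add: tt)
      finally show ?thesis .
    qed
    have "m'' X \<cdot> n'' (Cod S (m'' X)) \<cdot> p = m X \<cdot> ((m' A \<cdot> (n' (Cod S (m' A)) \<cdot> (n A \<cdot> p))))"
      unfolding m''_def n''_def by (simp add: tt)
    also have "\<dots> = m X \<cdot> ((m' A \<cdot> (n' (Cod S (m' A)) \<cdot> q)) \<cdot> n B)" unfolding nq by (simp add: tt)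
    also have "\<dots> = p" by (simp only: e2 pq[symmetric])
    finally show "m'' (Dom S p) \<cdot> n'' (Cod S (m'' (Dom S p))) \<cdot> p = p" by (simp add: t)
    have "p \<cdot> m'' Y \<cdot> n'' (Cod S (m'' Y)) = (p \<cdot> m Y) \<cdot> ((m' B \<cdot> n' (Cod S (m' B)))) \<cdot> n B"
      unfolding m''_def n''_def by (simp add: tt)
    also have "\<dots> = m X \<cdot> ((q \<cdot> (m' B \<cdot> n' (Cod S (m' B)))) \<cdot> n B)" unfolding mq by (simp add: tt)
    also have "\<dots> = p" by (simp only: e2 pq[symmetric])
    finally show "p \<cdot> m'' (Cod S p) \<cdot> n'' (Cod S (m'' (Cod S p))) = p" by (simp add: t)
  qed
qed

lemma equivalent_sets_trans:
  assumes sub: "P \<subseteq> Arr S" "Q \<subseteq> Arr S" "R \<subseteq> Arr S"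
    and "equivalent_sets S P Q" "equivalent_sets S Q R"
  shows "equivalent_sets S P R"
proof -
  obtain m n where 1: "equivalence_families S P Q m n" using assms by (auto simp: equivalent_sets_def)
  obtain m' n' where 2: "equivalence_families S Q R m' n'" using assms by (auto simp: equivalent_sets_def)
  note 1 = 1[unfolded equivalence_families_def] and 2 = 2[unfolded equivalence_families_def]
  define m'' n'' where "m'' = (\<lambda>X. m X \<cdot> m' (Cod S (m X)))" and "n'' = (\<lambda>Z. n' Z \<cdot> n (Cod S (n' Z)))"
  have c1: "conj_by S m n ` P \<subseteq> Q" "conj_by S n' m' ` R \<subseteq> Q" using 1 2 by (auto simp: bij_betw_def)
  note A = inverse_at_trans[of P Q m n R m' n', folded m''_def n''_def]
  note B = inverse_at_trans[of R Q n' m' P n m, folded m''_def n''_def]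
  have eA: "conj_by S m'' n'' p = (conj_by S m' n' \<circ> conj_by S m n) p" if "p \<in> P" for p
    using A(2)[OF _ _ _ _ _ _ _ _ _ that] sub 1 2 c1 by simp
  have eB: "conj_by S n'' m'' p = (conj_by S n m \<circ> conj_by S n' m') p" if "p \<in> R" for p
    using B(2)[OF _ _ _ _ _ _ _ _ _ that] sub 1 2 c1 by simp
  have "bij_betw (conj_by S m' n' \<circ> conj_by S m n) P R" "bij_betw (conj_by S n m \<circ> conj_by S n' m') R P"
    using 1 2 by (auto intro: bij_betw_trans)
  hence "bij_betw (conj_by S m'' n'') P R" "bij_betw (conj_by S n'' m'') R P"
    by (simp_all only: bij_betw_cong[of P _ _ R, OF eA] bij_betw_cong[of R _ _ P, OF eB])
  hence "equivalence_families S P R m'' n''"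
    unfolding equivalence_families_def using A(1,3) B(1,3) sub 1 2 c1 by simp
  thus ?thesis by (auto simp: equivalent_sets_def)
qed

lemma equiv_preim_rel: "equiv (preims S T \<phi>) (preim_rel S T \<phi>)"
proof -
  have sub: "P \<subseteq> Arr S" if "P \<in> preims S T \<phi>" for P
    using that by (auto simp: preims_def preim_def)
  have sym: "equivalent_sets S P Q \<Longrightarrow> equivalent_sets S Q P" for P Q
    unfolding equivalent_sets_def equivalence_families_def by blast
  show ?thesis
  proof (rule equivI)
    show "preim_rel S T \<phi> \<subseteq> preims S T \<phi> \<times> preims S T \<phi>" by (auto simp: preim_rel_def)
    show "refl_on (preims S T \<phi>) (preim_rel S T \<phi>)" by (auto simp: refl_on_def preim_rel_def)
    show "sym (preim_rel S T \<phi>)" using sym by (auto simp: sym_def preim_rel_def)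
    show "trans (preim_rel S T \<phi>)"
    proof (rule transI)
      fix P Q R assume "(P, Q) \<in> preim_rel S T \<phi>" "(Q, R) \<in> preim_rel S T \<phi>"
      thus "(P, R) \<in> preim_rel S T \<phi>"
        using equivalent_sets_trans[of P Q R] sub[of P] sub[of Q] sub[of R]
        by (auto simp: preim_rel_def)
    qed
  qed
qed

lemma kernel_choice_exists: "\<exists>rep mto mfrom. kernel_choice S T \<phi> rep mto mfrom"
proof -
  define rep :: "'a set set \<Rightarrow> 'a set" where "rep C = (SOME P. P \<in> C)" for C
  have "rep C \<in> C" if "C \<in> preims S T \<phi> // preim_rel S T \<phi>" for C
    using in_quotient_imp_non_empty[OF equiv_preim_rel that] by (auto simp: rep_def some_in_eq)
  moreover have "\<forall>f. \<exists>m n. has_families S T \<phi> rep f \<longrightarrow>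
      equivalence_families S (preim S \<phi> f) (rep_preim S T \<phi> rep f) m n"
    by (auto simp: has_families_def equivalent_sets_def)
  then obtain mto mfrom where "\<forall>f. has_families S T \<phi> rep f \<longrightarrow>
      equivalence_families S (preim S \<phi> f) (rep_preim S T \<phi> rep f) (mto f) (mfrom f)"
    by metis
  ultimately show ?thesis unfolding kernel_choice_def by blast
qed

end


section \<open>The pinhole cascade product\<close>

text \<open>An arrow of the preimage of \<open>f\<close> may be interchangeable although the preimage as a whole has no
  families; there is then nothing to transport along, and the arrow is left unchanged.\<close>

definition enc ::
    "('o, 'a) sgpd \<Rightarrow> ('p, 'b) sgpd \<Rightarrow> ('a \<Rightarrow> 'b set) \<Rightarrow>
     ('a set set \<Rightarrow> 'a set) \<Rightarrow> ('b \<Rightarrow> 'o \<Rightarrow> 'a) \<Rightarrow> ('b \<Rightarrow> 'o \<Rightarrow> 'a) \<Rightarrow> 'b \<Rightarrow> 'a \<Rightarrow> 'a" where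
  "enc S T \<phi> rep mto mfrom f a =
    (if interchangeable S a \<and> has_families S T \<phi> rep f then conj_by S (mto f) (mfrom f) a else a)"

definition dec ::
    "('o, 'a) sgpd \<Rightarrow> ('p, 'b) sgpd \<Rightarrow> ('a \<Rightarrow> 'b set) \<Rightarrow>
     ('a set set \<Rightarrow> 'a set) \<Rightarrow> ('b \<Rightarrow> 'o \<Rightarrow> 'a) \<Rightarrow> ('b \<Rightarrow> 'o \<Rightarrow> 'a) \<Rightarrow> 'b \<Rightarrow> 'a \<Rightarrow> 'a" where
  "dec S T \<phi> rep mto mfrom f a =
    (if interchangeable S a \<and> has_families S T \<phi> rep f then conj_by S (mfrom f) (mto f) a else a)"

text \<open>Objects are pairs of objects, so that \<open>(f, a)\<close> and \<open>(g, b)\<close> are composable iff \<open>f\<close> and \<open>g\<close> are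
  composable in \<open>T\<close> and the decoded arrows are composable in \<open>S\<close>.\<close>

definition pinhole_cascade ::
    "('o, 'a) sgpd \<Rightarrow> ('p, 'b) sgpd \<Rightarrow> ('a \<Rightarrow> 'b set) \<Rightarrow>
     ('a set set \<Rightarrow> 'a set) \<Rightarrow> ('b \<Rightarrow> 'o \<Rightarrow> 'a) \<Rightarrow> ('b \<Rightarrow> 'o \<Rightarrow> 'a) \<Rightarrow> ('p \<times> 'o, 'b \<times> 'a) sgpd" where
  "pinhole_cascade S T \<phi> rep mto mfrom =
    \<lparr>Ob = Ob T \<times> Ob S,
     Arr = (\<Union>f \<in> Arr T. {f} \<times> rep_preim S T \<phi> rep f),
     Dom = (\<lambda>(f, a). (Dom T f, Dom S (dec S T \<phi> rep mto mfrom f a))),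
     Cod = (\<lambda>(f, a). (Cod T f, Cod S (dec S T \<phi> rep mto mfrom f a))),
     Comp = (\<lambda>(f, a) (g, b).
       (f \<cdot>\<^bsub>T\<^esub> g,
        enc S T \<phi> rep mto mfrom (f \<cdot>\<^bsub>T\<^esub> g)
          (dec S T \<phi> rep mto mfrom f a \<cdot>\<^bsub>S\<^esub> dec S T \<phi> rep mto mfrom g b)))\<rparr>"

lemma Arr_pinhole_cascade_subset:
  "Arr (pinhole_cascade S T \<phi> rep mto mfrom) \<subseteq> Arr T \<times> kernel S T \<phi> rep"
  by (auto simp: pinhole_cascade_def kernel_def)

end

theory Submission
  imports Defs
begin

text \<open>The emulation sends \<open>a\<close> to all pairs \<open>(f, enc f a)\<close> with \<open>f \<in> \<phi> a\<close>. It is injective because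
  encoding and decoding are mutually inverse between a preimage and its representative. The one
  delicate point is that they leave non-interchangeable arrows alone: an arrow is always equivalent
  to its conjugate, so a non-interchangeable arrow equals its conjugate, and both branches of the
  case distinction amount to conjugation.\<close>

lemma equivalence_families_sym:
  "equivalence_families S P Q m n \<Longrightarrow> equivalence_families S Q P n m"
  by (auto simp: equivalence_families_def)

context semigroupoid
begin

lemma inverse_atD:
  assumes "inverse_at S P m n" "p \<in> P"
  shows "m (Dom S p) \<cdot> n (Cod S (m (Dom S p))) \<cdot> p = p"
    and "p \<cdot> m (Cod S p) \<cdot> n (Cod S (m (Cod S p))) = p"
  using assms by (simp_all add: inverse_at_def)

text \<open>Conjugating along the families and back only inserts round trips at the two ends of
  \<open>p\<close>, and \<open>p\<close> absorbs both by the relative inverse condition. The four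
  arrows making up these round trips are just what equivalence of \<open>p\<close> with its
  conjugate asks for.\<close>

lemma
  assumes P: "P \<subseteq> Arr S" and Q: "Q \<subseteq> Arr S"
    and fam: "equivalence_families S P Q m n" and p: "p \<in> P"
  shows conj_by_in: "conj_by S m n p \<in> Q"
    and conj_by_inverse: "conj_by S n m (conj_by S m n p) = p"
    and equivalent_conj_by: "equivalent_arrows S p (conj_by S m n p)"
proof -
  define X Y where "X = Dom S p" and "Y = Cod S p"
  \<comment> \<open>\<open>A\<close> and \<open>B\<close> are the objects of \<open>Q\<close>
    matched with the ends \<open>X\<close> and \<open>Y\<close> of \<open>p\<close>.\<close>
  define A B where "A = Cod S (m X)" and "B = Cod S (m Y)"
  define q where "q = conj_by S m n p"
  have XY: "X \<in> Ob_of S P" "Y \<in> Ob_of S P" and pA: "p \<in> Arr S"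
    using p P by (auto simp: Ob_of_def X_def Y_def)
  have fam_m: "m Z \<in> Arr S \<and> Dom S (m Z) = Z \<and> Cod S (m Z) \<in> Ob_of S Q" if "Z \<in> Ob_of S P" for Z
    using fam that by (auto simp: equivalence_families_def arrow_family_def)
  have fam_n: "n Z \<in> Arr S \<and> Dom S (n Z) = Z" if "Z \<in> Ob_of S Q" for Z
    using fam that by (auto simp: equivalence_families_def arrow_family_def)
  have mXY: "m X \<in> Arr S" "Dom S (m X) = X" "m Y \<in> Arr S" "Dom S (m Y) = Y"
    and AB: "A \<in> Ob_of S Q" "B \<in> Ob_of S Q"
    using fam_m XY by (auto simp: A_def B_def)
  have nAB: "n A \<in> Arr S" "Dom S (n A) = A" "n B \<in> Arr S" "Dom S (n B) = B"
    using fam_n AB by auto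
  have return: "Cod S (n A) = X" "Cod S (n B) = Y"
    using fam XY by (auto simp: equivalence_families_def inverse_at_def A_def B_def)
  note objects = X_def[symmetric] Y_def[symmetric] A_def[symmetric] B_def[symmetric]
  note simps = objects pA mXY nAB return comp_simps
  \<comment> \<open>Composites are kept bracketed to the right, the normal form that
    \<open>comp_simps\<close> produces.\<close>
  have q_eq: "q = n A \<cdot> (p \<cdot> m Y)"
    by (simp add: q_def conj_by_def simps)
  have dq: "q \<in> Arr S" "Dom S q = A" "Cod S q = B"
    by (simp_all add: q_eq simps)
  show in_Q: "conj_by S m n p \<in> Q"
    using fam p by (auto simp: equivalence_families_def bij_betw_def)
  have inv_p: "m X \<cdot> (n A \<cdot> p) = p" "p \<cdot> (m Y \<cdot> n B) = p"
    using inverse_atD[of P m n p] fam p by (simp_all add: equivalence_families_def simps)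
  \<comment> \<open>This is the half of the inverse condition that concerns \<open>Q\<close>, with
    the families exchanged; \<open>in_Q\<close> makes it available for \<open>q\<close>.\<close>
  have inv_q: "n A \<cdot> (m X \<cdot> q) = q" "q \<cdot> (n B \<cdot> m Y) = q"
    using inverse_atD[of Q n m q] fam in_Q
    by (simp_all add: equivalence_families_def q_def[symmetric] dq simps)
  have p_eq: "p = m X \<cdot> (q \<cdot> n B)"
  proof -
    \<comment> \<open>Expanding \<open>q\<close> and reassociating places \<open>p\<close> between
      the round trips \<open>X\<close> to \<open>A\<close> to \<open>X\<close> and \<open>Y\<close>
      to \<open>B\<close> to \<open>Y\<close>, both absorbed by \<open>inv_p\<close>.\<close>
    have "m X \<cdot> (q \<cdot> n B) = (m X \<cdot> (n A \<cdot> p)) \<cdot> (m Y \<cdot> n B)"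
      by (simp add: q_eq simps)
    then show ?thesis by (simp add: inv_p)
  qed
  have "conj_by S n m q = m X \<cdot> (q \<cdot> n B)"
    by (simp add: conj_by_def dq simps)
  then show "conj_by S n m (conj_by S m n p) = p"
    by (simp only: p_eq[symmetric] q_def[symmetric])
  \<comment> \<open>In the order of the definition of \<open>equivalent_arrows\<close>, the
    witnesses are \<open>m X\<close>, \<open>n A\<close>, \<open>m Y\<close> and
    \<open>n B\<close>.\<close>
  have homs: "m X \<in> hom S X A" "n A \<in> hom S A X" "m Y \<in> hom S Y B" "n B \<in> hom S B Y"
    by (auto simp: hom_def simps)
  have eqs: "p = m X \<cdot> q \<cdot> n B" "q = n A \<cdot> p \<cdot> m Y" "m X \<cdot> n A \<cdot> p = p" "p \<cdot> m Y \<cdot> n B = p"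
      "n A \<cdot> m X \<cdot> q = q" "q \<cdot> n B \<cdot> m Y = q"
    using p_eq[symmetric] q_eq[symmetric] inv_p inv_q by (simp_all add: dq simps)
  show "equivalent_arrows S p (conj_by S m n p)"
    unfolding equivalent_arrows_def q_def[symmetric] dq objects
    using homs eqs pA dq(1) by blast
qed

lemma interchangeable_conj_by:
  assumes "P \<subseteq> Arr S" "Q \<subseteq> Arr S" "equivalence_families S P Q m n" "p \<in> P"
  shows "(if interchangeable S p then conj_by S m n p else p) = conj_by S m n p"
proof (cases "conj_by S m n p = p")
  \<comment> \<open>The conjugate is then itself another arrow equivalent to \<open>p\<close>, so
    the test for interchangeability succeeds.\<close>
  case False
  then show ?thesis
    using equivalent_conj_by[OF assms] unfolding interchangeable_def by auto
qed simp

end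

text \<open>The representative lies in the class of the preimage, and being related in
  \<open>preim_rel\<close> means equality or the existence of families. So the coding can fall back
  to the identity exactly where no families exist.\<close>

lemma (in semigroupoid) rep_preim_cases:
  assumes "kernel_choice S T \<phi> rep mto mfrom" and "f \<in> Arr T"
  shows "rep_preim S T \<phi> rep f \<in> preims S T \<phi>"
    and "rep_preim S T \<phi> rep f = preim S \<phi> f \<or> has_families S T \<phi> rep f"
proof -
  have "preim S \<phi> f \<in> preims S T \<phi>"
    using assms(2) by (auto simp: preims_def)
  then have "rep_preim S T \<phi> rep f \<in> preim_rel S T \<phi> `` {preim S \<phi> f}"
    using assms(1) unfolding kernel_choice_def rep_preim_def by (meson quotientI)
  then show "rep_preim S T \<phi> rep f \<in> preims S T \<phi>"
    and "rep_preim S T \<phi> rep f = preim S \<phi> f \<or> has_families S T \<phi> rep f"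
    by (auto simp: preim_rel_def has_families_def)
qed

lemma (in semigroupoid)
  assumes choice: "kernel_choice S T \<phi> rep mto mfrom" and f: "f \<in> Arr T"
  shows enc_in: "a \<in> preim S \<phi> f \<Longrightarrow> enc S T \<phi> rep mto mfrom f a \<in> rep_preim S T \<phi> rep f"
    and dec_enc: "a \<in> preim S \<phi> f \<Longrightarrow>
      dec S T \<phi> rep mto mfrom f (enc S T \<phi> rep mto mfrom f a) = a"
    and dec_in: "a' \<in> rep_preim S T \<phi> rep f \<Longrightarrow> dec S T \<phi> rep mto mfrom f a' \<in> preim S \<phi> f"
proof -
  let ?P = "preim S \<phi> f" and ?Q = "rep_preim S T \<phi> rep f"
  let ?enc = "enc S T \<phi> rep mto mfrom f" and ?dec = "dec S T \<phi> rep mto mfrom f"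
  have "(\<forall>a \<in> ?P. ?enc a \<in> ?Q \<and> ?dec (?enc a) = a) \<and> (\<forall>a' \<in> ?Q. ?dec a' \<in> ?P)"
  proof (cases "has_families S T \<phi> rep f")
    \<comment> \<open>The preimage is its own representative, and both maps are the
      identity.\<close>
    case False
    then show ?thesis
      using rep_preim_cases(2)[OF choice f] by (auto simp: enc_def dec_def)
  next
    case True
    have P: "?P \<subseteq> Arr S" by (auto simp: preim_def)
    have Q: "?Q \<subseteq> Arr S"
      using rep_preim_cases(1)[OF choice f] by (auto simp: preims_def preim_def)
    have fam: "equivalence_families S ?P ?Q (mto f) (mfrom f)"
      using True choice f by (auto simp: kernel_choice_def)
    \<comment> \<open>Decoding is encoding with the roles of the two families exchanged, so every
      fact about conjugation is used in both directions.\<close>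
    note fam' = equivalence_families_sym[OF fam]
    have "?enc a = conj_by S (mto f) (mfrom f) a" if "a \<in> ?P" for a
      using interchangeable_conj_by[OF P Q fam that] True by (simp add: enc_def)
    moreover have "?dec a = conj_by S (mfrom f) (mto f) a" if "a \<in> ?Q" for a
      using interchangeable_conj_by[OF Q P fam' that] True by (simp add: dec_def)
    ultimately show ?thesis
      using conj_by_in[OF P Q fam] conj_by_in[OF Q P fam'] conj_by_inverse[OF P Q fam] by simp
  qed
  then show "a \<in> ?P \<Longrightarrow> ?enc a \<in> ?Q" "a \<in> ?P \<Longrightarrow> ?dec (?enc a) = a" "a' \<in> ?Q \<Longrightarrow> ?dec a' \<in> ?P"
    by blast+
qed

text \<open>Needed to bring the composite of two decoded arrows into the scope of encoding at the
  product in \<open>T\<close>; there a subsequent decoding undoes the encoding.\<close>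

lemma (in relational_functor) preim_comp:
  assumes "a \<in> preim S \<phi> f" "b \<in> preim S \<phi> g" "Cod S a = Dom S b" "Cod T f = Dom T g"
  shows "Comp S a b \<in> preim S \<phi> (Comp T f g)"
proof -
  have "Comp T f g \<in> set_comp T (\<phi> a) (\<phi> b)"
    using assms by (auto simp: set_comp_def preim_def)
  then show ?thesis
    using assms comp_subset[of a b] S.Comp_in_Arr[of a b] by (auto simp: preim_def)
qed

text \<open>Decoding the second component turns the composition of the cascade into componentwise
  composition in \<open>T\<close> and \<open>S\<close>, so the axioms are inherited from these
  two.\<close>

lemma (in relational_functor) semigroupoid_pinhole_cascade:
  assumes choice: "kernel_choice S T \<phi> rep mto mfrom"
  shows "semigroupoid (pinhole_cascade S T \<phi> rep mto mfrom)"
proof -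
  define W where "W = pinhole_cascade S T \<phi> rep mto mfrom"
  define e d where "e = enc S T \<phi> rep mto mfrom" and "d = dec S T \<phi> rep mto mfrom"
  note W = W_def pinhole_cascade_def e_def[symmetric] d_def[symmetric]
  have simps:
    "Ob W = Ob T \<times> Ob S"
    "(f, a) \<in> Arr W \<longleftrightarrow> f \<in> Arr T \<and> a \<in> rep_preim S T \<phi> rep f"
    "Dom W (f, a) = (Dom T f, Dom S (d f a))"
    "Cod W (f, a) = (Cod T f, Cod S (d f a))"
    "Comp W (f, a) (g, b) = (Comp T f g, e (Comp T f g) (Comp S (d f a) (d g b)))" for f a g b
    by (auto simp: W)
  have d_in: "d f a \<in> preim S \<phi> f" if "(f, a) \<in> Arr W" for f a
    using that S.dec_in[OF choice] by (auto simp: simps d_def)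
  have d_Arr: "d f a \<in> Arr S" if "(f, a) \<in> Arr W" for f a
    using d_in[OF that] by (simp add: preim_def)
  \<comment> \<open>The second fact is the key: decoding a product yields the product of the decoded
    factors.\<close>
  have comp: "Comp W (f, a) (g, b) \<in> Arr W"
      "d (Comp T f g) (e (Comp T f g) (Comp S (d f a) (d g b))) = Comp S (d f a) (d g b)"
    if "(f, a) \<in> Arr W" "(g, b) \<in> Arr W" "Cod W (f, a) = Dom W (g, b)" for f a g b
  proof -
    have "Comp T f g \<in> Arr T"
      using that T.Comp_in_Arr by (simp add: simps)
    moreover have "Comp S (d f a) (d g b) \<in> preim S \<phi> (Comp T f g)"
      using that by (intro preim_comp d_in) (auto simp: simps)
    ultimately show "Comp W (f, a) (g, b) \<in> Arr W"
      "d (Comp T f g) (e (Comp T f g) (Comp S (d f a) (d g b))) = Comp S (d f a) (d g b)"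
      using S.enc_in[OF choice] S.dec_enc[OF choice] by (simp_all add: simps e_def d_def)
  qed
  have "semigroupoid W"
  proof (unfold_locales, goal_cases)
    case (1 f) then show ?case
      by (cases f) (use d_Arr T.Dom_in_Ob S.Dom_in_Ob in \<open>auto simp: simps(1-4)\<close>)
  next
    case (2 f) then show ?case
      by (cases f) (use d_Arr T.Cod_in_Ob S.Cod_in_Ob in \<open>auto simp: simps(1-4)\<close>)
  next
    case (3 f g) then show ?case
      using comp(1) by (metis surj_pair)
  next
    case (4 f g)
    obtain f1 f2 g1 g2 where fg: "f = (f1, f2)" "g = (g1, g2)" by fastforce
    note prems = 4[unfolded fg]
    have "f1 \<in> Arr T" "g1 \<in> Arr T" "Cod T f1 = Dom T g1" "Cod S (d f1 f2) = Dom S (d g1 g2)"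
      using prems by (auto simp: simps)
    then show ?case
      using comp(2)[OF prems] d_Arr[OF prems(1)] d_Arr[OF prems(2)]
      by (simp add: fg simps T.Dom_Comp S.Dom_Comp)
  next
    case (5 f g)
    obtain f1 f2 g1 g2 where fg: "f = (f1, f2)" "g = (g1, g2)" by fastforce
    note prems = 5[unfolded fg]
    have "f1 \<in> Arr T" "g1 \<in> Arr T" "Cod T f1 = Dom T g1" "Cod S (d f1 f2) = Dom S (d g1 g2)"
      using prems by (auto simp: simps)
    then show ?case
      using comp(2)[OF prems] d_Arr[OF prems(1)] d_Arr[OF prems(2)]
      by (simp add: fg simps T.Cod_Comp S.Cod_Comp)
  next
    case (6 f g h)
    obtain f1 f2 g1 g2 h1 h2 where fgh: "f = (f1, f2)" "g = (g1, g2)" "h = (h1, h2)"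
      by (metis surj_pair)
    note prems = 6[unfolded fgh]
    have "f1 \<in> Arr T" "g1 \<in> Arr T" "h1 \<in> Arr T" "Cod T f1 = Dom T g1" "Cod T g1 = Dom T h1"
      "Cod S (d f1 f2) = Dom S (d g1 g2)" "Cod S (d g1 g2) = Dom S (d h1 h2)"
      using prems by (auto simp: simps)
    \<comment> \<open>For both inner products the intermediate encoding is cancelled by
      \<open>comp(2)\<close>. Each bracketing then becomes a single encoding of the threefold
      product of decoded arrows, where associativity in \<open>T\<close> and \<open>S\<close>
      applies.\<close>
    then show ?case
      using comp(2)[OF prems(1,2,4)] comp(2)[OF prems(2,3,5)]
        d_Arr[OF prems(1)] d_Arr[OF prems(2)] d_Arr[OF prems(3)]
      by (simp add: fgh simps T.Comp_assoc S.Comp_assoc)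
  qed
  then show ?thesis by (simp add: W_def)
qed

text \<open>Decoding recovers \<open>a\<close> from each of its images. Hence, for composable
  \<open>a\<close> and \<open>b\<close>, images compose in the cascade as soon as their first
  components compose in \<open>T\<close>, and both functor conditions descend from those of
  \<open>\<phi>\<close>.\<close>

theorem (in relational_functor) pinhole_cascade_emulates:
  assumes choice: "kernel_choice S T \<phi> rep mto mfrom"
  shows "injective_relational_functor S (pinhole_cascade S T \<phi> rep mto mfrom)
    (\<lambda>a. (\<lambda>f. (f, enc S T \<phi> rep mto mfrom f a)) ` \<phi> a)"
proof -
  define W where "W = pinhole_cascade S T \<phi> rep mto mfrom"
  define e d where "e = enc S T \<phi> rep mto mfrom" and "d = dec S T \<phi> rep mto mfrom"
  define \<psi> where "\<psi> a = (\<lambda>f. (f, e f a)) ` \<phi> a" for a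
  interpret W: semigroupoid W
    unfolding W_def by (rule semigroupoid_pinhole_cascade[OF choice])
  note W = W_def pinhole_cascade_def e_def[symmetric] d_def[symmetric]
  have simps:
    "(f, a) \<in> Arr W \<longleftrightarrow> f \<in> Arr T \<and> a \<in> rep_preim S T \<phi> rep f"
    "Dom W (f, a) = (Dom T f, Dom S (d f a))"
    "Cod W (f, a) = (Cod T f, Cod S (d f a))"
    "Comp W (f, a) (g, b) = (Comp T f g, e (Comp T f g) (Comp S (d f a) (d g b)))" for f a g b
    by (auto simp: W)
  have e_in: "e f a \<in> rep_preim S T \<phi> rep f" and d_e: "d f (e f a) = a" and f_in: "f \<in> Arr T"
    if "a \<in> Arr S" "f \<in> \<phi> a" for f a
  proof -
    show "f \<in> Arr T" using that image_subset by auto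
    moreover have "a \<in> preim S \<phi> f" using that by (simp add: preim_def)
    ultimately show "e f a \<in> rep_preim S T \<phi> rep f" "d f (e f a) = a"
      using S.enc_in[OF choice] S.dec_enc[OF choice] by (simp_all add: e_def d_def)
  qed
  have "injective_relational_functor S W \<psi>"
  proof (unfold_locales, goal_cases)
    case (1 a) then show ?case using e_in f_in by (auto simp: \<psi>_def simps)
  next
    case (2 a) then show ?case using image_nonempty by (auto simp: \<psi>_def)
  next
    case (3 a b)
    show ?case
    proof
      fix w assume "w \<in> set_comp W (\<psi> a) (\<psi> b)"
      \<comment> \<open>By \<open>d_e\<close> the product decodes its factors to \<open>a\<close>
        and \<open>b\<close>, so its second component is the encoding of their composite.\<close>
      then obtain f g where fg: "f \<in> \<phi> a" "g \<in> \<phi> b" "Cod T f = Dom T g"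
        and w: "w = (Comp T f g, e (Comp T f g) (Comp S a b))"
        using 3 by (auto simp: set_comp_def \<psi>_def simps d_e)
      have "Comp T f g \<in> set_comp T (\<phi> a) (\<phi> b)"
        using fg by (auto simp: set_comp_def)
      then show "w \<in> \<psi> (Comp S a b)"
        using comp_subset[OF 3] by (auto simp: w \<psi>_def)
    qed
  next
    case (4 a b)
    \<comment> \<open>A composable pair of images in \<open>T\<close> is lifted to the cascade; its
      \<open>S\<close> components match because they decode to \<open>a\<close> and
      \<open>b\<close>.\<close>
    then obtain f g where fg: "f \<in> \<phi> a" "g \<in> \<phi> b" "Cod T f = Dom T g"
      using comp_nonempty[of a b] by (auto simp: set_comp_def)
    have "Cod W (f, e f a) = Dom W (g, e g b)"
      using 4 fg by (simp add: simps d_e)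
    moreover have "(f, e f a) \<in> \<psi> a" "(g, e g b) \<in> \<psi> b"
      using fg by (auto simp: \<psi>_def)
    ultimately show ?case unfolding set_comp_def by blast
  next
    case (5 a b)
    \<comment> \<open>A common image has one first component \<open>f\<close> for both arrows, so
      the same decoding at \<open>f\<close> recovers \<open>a\<close> and \<open>b\<close> from the
      same code.\<close>
    then obtain f where "f \<in> \<phi> a" "f \<in> \<phi> b" "e f a = e f b"
      by (auto simp: \<psi>_def)
    then show ?case using 5 d_e by metis
  qed
  then show ?thesis by (simp add: W_def \<psi>_def[abs_def] e_def)
qed

text \<open>Representatives and families enter as arbitrary parameters, so the result covers every
  admissible choice; \<open>kernel_choice_exists\<close> shows that such a choice can always be
  made.\<close>

theorem theorem4p7:
  fixes S :: "('o, 'a) sgpd" and T :: "('p, 'b) sgpd" and \<phi> :: "'a \<Rightarrow> 'b set"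
    and rep :: "'a set set \<Rightarrow> 'a set" and mto mfrom :: "'b \<Rightarrow> 'o \<Rightarrow> 'a"
  assumes "finite_semigroupoid S" and "finite_semigroupoid T"
    and "surjective_relational_functor S T \<phi>"
    and "kernel_choice S T \<phi> rep mto mfrom"
  shows "\<exists>\<psi>. injective_relational_functor S (pinhole_cascade S T \<phi> rep mto mfrom) \<psi>"
proof -
  interpret surjective_relational_functor S T \<phi> by fact
  show ?thesis using pinhole_cascade_emulates[OF assms(4)] by blast
qed

end
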